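(* Let $(f_n)_{n\in\mathbb{N}}$ be a martingale on a filtered probability space $(\Omega,(\mathcal{F}_n)_{n\in\mathbb{N}})$ with values in a Hilbert space $(H,|\cdot|)$ and with $f_0=0$. Let $w$ be an integrable $A_1$ weight, with $A_1$ characteristic $[w]_{A_1}<\infty$. Then, for every $N\in\mathbb{N}$, $$\mathbb{E}\Bigl( \bigl( \sum_{n=1}^{N} |df_n|^2\bigr)^{1/2} w\Bigr) \leq 2 [w]_{A_1}^{1/2}\, \mathbb{E}( f^* w ).$$
   Context: Here $\mathbb{N}=\{0,1,2,\dots\}$. A weight is a positive random variable on $\Omega$. Notation: $df_n=f_n-f_{n-1}$ (for $n\geq 1$), $f^* = \sup_{n\in\mathbb{N}} |f_n|$, $w^*=\sup_{n\in\mathbb{N}} \mathbb{E}(w|\mathcal{F}_n)$. The $A_1$ characteristic of a weight $w$ is the smallest constant $[w]_{A_1}$ such that $w^*\leq [w]_{A_1} w$ (almost surely); $w$ is an $A_1$ weight if such a finite constant exists. Expectations of nonnegative random variables take values in $[0,\infty]$. *)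

theory Defs
  imports "HOL-Probability.Probability"
begin

text \<open>
  The library's Bochner integral is restricted to second countable, hence separable, target
  spaces. The following is the same definition for an arbitrary Banach space. Convergence in mean
  of simple functions makes every integrable function almost everywhere separably valued, so this
  is the usual Bochner (strong) integral.
\<close>

inductive has_strong_integral :: "'a measure \<Rightarrow> ('a \<Rightarrow> 'b::banach) \<Rightarrow> 'b \<Rightarrow> bool"
  for M f x where
  "f \<in> borel_measurable M \<Longrightarrow>
    (\<And>i. Bochner_Integration.simple_bochner_integrable M (s i)) \<Longrightarrow>
    (\<lambda>i. \<integral>\<^sup>+ x. ennreal (norm (f x - s i x)) \<partial>M) \<longlonglongrightarrow> 0 \<Longrightarrow>
    (\<lambda>i. Bochner_Integration.simple_bochner_integral M (s i)) \<longlonglongrightarrow> x \<Longrightarrow>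
    has_strong_integral M f x"

definition strongly_integrable :: "'a measure \<Rightarrow> ('a \<Rightarrow> 'b::banach) \<Rightarrow> bool" where
  "strongly_integrable M f \<longleftrightarrow> (\<exists>x. has_strong_integral M f x)"

definition strong_integral :: "'a measure \<Rightarrow> ('a \<Rightarrow> 'b::banach) \<Rightarrow> 'b" where
  "strong_integral M f =
    (if strongly_integrable M f then THE x. has_strong_integral M f x else 0)"

lemma has_strong_integral_iff_has_bochner_integral:
  fixes f :: "'a \<Rightarrow> 'b::{banach, second_countable_topology}"
  shows "has_strong_integral M f x \<longleftrightarrow> has_bochner_integral M f x"
  by (simp add: has_strong_integral.simps has_bochner_integral.simps)

lemma strongly_integrable_iff_integrable:
  fixes f :: "'a \<Rightarrow> 'b::{banach, second_countable_topology}"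
  shows "strongly_integrable M f \<longleftrightarrow> integrable M f"
  by (simp add: strongly_integrable_def has_strong_integral_iff_has_bochner_integral
      integrable.simps)

lemma strong_integral_eq_lebesgue_integral:
  fixes f :: "'a \<Rightarrow> 'b::{banach, second_countable_topology}"
  shows "strong_integral M f = integral\<^sup>L M f"
proof -
  have "has_strong_integral M f = has_bochner_integral M f"
    by (intro ext has_strong_integral_iff_has_bochner_integral)
  then show ?thesis
    by (simp add: strong_integral_def strongly_integrable_def lebesgue_integral_def)
qed

text \<open>
  \<open>is_cond_exp M G f g\<close>: the function \<open>g\<close> is a version of the conditional expectation of
  \<open>f\<close> given \<open>G\<close>. The library only provides conditional expectations of real-valued functions.
\<close>

definition is_cond_exp ::
  "'a measure \<Rightarrow> 'a measure \<Rightarrow> ('a \<Rightarrow> 'b::banach) \<Rightarrow> ('a \<Rightarrow> 'b) \<Rightarrow> bool" where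
  "is_cond_exp M G f g \<longleftrightarrow>
    g \<in> borel_measurable G \<and> strongly_integrable M f \<and> strongly_integrable M g \<and>
    (\<forall>A\<in>sets G. strong_integral M (\<lambda>x. indicator A x *\<^sub>R g x) =
      strong_integral M (\<lambda>x. indicator A x *\<^sub>R f x))"

definition martingale ::
  "'a measure \<Rightarrow> (nat \<Rightarrow> 'a measure) \<Rightarrow> (nat \<Rightarrow> 'a \<Rightarrow> 'b::banach) \<Rightarrow> bool" where
  "martingale M F f \<longleftrightarrow>
    (\<forall>n. f n \<in> borel_measurable (F n) \<and> strongly_integrable M (f n)) \<and>
    (\<forall>m n. m \<le> n \<longrightarrow> is_cond_exp M (F m) (f n) (f m))"

definition martingale_max :: "(nat \<Rightarrow> 'a \<Rightarrow> 'b::real_normed_vector) \<Rightarrow> 'a \<Rightarrow> ennreal" where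
  "martingale_max f x = (SUP n. ennreal (norm (f n x)))"

definition square_fun :: "nat \<Rightarrow> (nat \<Rightarrow> 'a \<Rightarrow> 'b::real_normed_vector) \<Rightarrow> 'a \<Rightarrow> real" where
  "square_fun N f x = sqrt (\<Sum>n=1..N. (norm (f n x - f (n - 1) x))\<^sup>2)"

definition weight :: "'a measure \<Rightarrow> ('a \<Rightarrow> real) \<Rightarrow> bool" where
  "weight M w \<longleftrightarrow> w \<in> borel_measurable M \<and> (AE x in M. 0 < w x)"

definition weight_max ::
  "'a measure \<Rightarrow> (nat \<Rightarrow> 'a measure) \<Rightarrow> ('a \<Rightarrow> real) \<Rightarrow> 'a \<Rightarrow> ennreal" where
  "weight_max M F w x = (SUP n. nn_cond_exp M (F n) (\<lambda>y. ennreal (w y)) x)"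

definition A1_bounds :: "'a measure \<Rightarrow> (nat \<Rightarrow> 'a measure) \<Rightarrow> ('a \<Rightarrow> real) \<Rightarrow> real set" where
  "A1_bounds M F w = {C. AE x in M. weight_max M F w x \<le> ennreal (C * w x)}"

definition A1_weight :: "'a measure \<Rightarrow> (nat \<Rightarrow> 'a measure) \<Rightarrow> ('a \<Rightarrow> real) \<Rightarrow> bool" where
  "A1_weight M F w \<longleftrightarrow> weight M w \<and> A1_bounds M F w \<noteq> {}"

text \<open>The infimum is attained, see \<open>A1_char_in_A1_bounds\<close> below.\<close>

definition A1_char :: "'a measure \<Rightarrow> (nat \<Rightarrow> 'a measure) \<Rightarrow> ('a \<Rightarrow> real) \<Rightarrow> real" where
  "A1_char M F w = Inf (A1_bounds M F w)"

lemma A1_bounds_nonneg: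
  assumes "prob_space M" "\<And>n. subalgebra M (F n)" "weight M w" "C \<in> A1_bounds M F w"
  shows "0 \<le> C"
proof (rule ccontr)
  assume C: "\<not> 0 \<le> C"
  interpret prob_space M by fact
  interpret finite_measure_subalgebra M "F 0"
    by unfold_locales (rule assms)
  have [measurable]: "w \<in> borel_measurable M" and pos: "AE x in M. 0 < w x"
    using assms(3) by (auto simp: weight_def)
  have "AE x in M. weight_max M F w x \<le> ennreal (C * w x)"
    using assms(4) by (simp add: A1_bounds_def)
  with pos have z: "AE x in M. nn_cond_exp M (F 0) (\<lambda>y. ennreal (w y)) x = 0"
  proof eventually_elim
    case (elim x)
    have "C * w x \<le> 0"
      using C elim(1) by (simp add: mult_nonpos_nonneg)
    then have "weight_max M F w x = 0"
      using elim(2) by (simp add: ennreal_neg)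
    moreover have "nn_cond_exp M (F 0) (\<lambda>y. ennreal (w y)) x \<le> weight_max M F w x"
      unfolding weight_max_def by (rule SUP_upper) simp
    ultimately show ?case by simp
  qed
  have "(\<integral>\<^sup>+x. ennreal (w x) \<partial>M) =
      (\<integral>\<^sup>+x. nn_cond_exp M (F 0) (\<lambda>y. ennreal (w y)) x \<partial>M)"
    using nn_cond_exp_intg[of "\<lambda>_. 1" "\<lambda>y. ennreal (w y)"] by simp
  also have "\<dots> = (\<integral>\<^sup>+x. 0 \<partial>M)"
    by (rule nn_integral_cong_AE) (rule z)
  finally have "AE x in M. ennreal (w x) = 0"
    by (simp add: nn_integral_0_iff_AE)
  with pos have "AE x in M. False"
    by eventually_elim (simp add: ennreal_eq_0_iff)
  then show False
    by simp
qed

lemma A1_char_in_A1_bounds: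
  assumes "prob_space M" "\<And>n. subalgebra M (F n)" "A1_weight M F w"
  shows "A1_char M F w \<in> A1_bounds M F w"
proof -
  have wt: "weight M w" and ne: "A1_bounds M F w \<noteq> {}"
    using assms(3) by (auto simp: A1_weight_def)
  define c where "c = A1_char M F w"
  have step: "AE x in M. weight_max M F w x \<le> ennreal ((c + 1 / Suc k) * w x)" for k
  proof -
    have "Inf (A1_bounds M F w) < c + 1 / Suc k"
      by (simp add: c_def A1_char_def)
    then obtain C where C: "C \<in> A1_bounds M F w" "C < c + 1 / Suc k"
      using cInf_lessD[OF ne] by blast
    have "AE x in M. 0 < w x" "AE x in M. weight_max M F w x \<le> ennreal (C * w x)"
      using wt C(1) by (auto simp: weight_def A1_bounds_def)
    then show ?thesis
    proof eventually_elim
      case (elim x)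
      have "C * w x \<le> (c + 1 / Suc k) * w x"
        using elim(1) C(2) by (intro mult_right_mono) auto
      with elim(2) show ?case
        by (meson ennreal_leI order_trans)
    qed
  qed
  then have "AE x in M. \<forall>k. weight_max M F w x \<le> ennreal ((c + 1 / Suc k) * w x)"
    by (simp add: AE_all_countable)
  then have "AE x in M. weight_max M F w x \<le> ennreal (c * w x)"
  proof eventually_elim
    case (elim x)
    have "(\<lambda>k. (c + 1 / Suc k) * w x) \<longlonglongrightarrow> (c + 0) * w x"
      using LIMSEQ_inverse_real_of_nat
      by (intro tendsto_mult tendsto_add tendsto_const) (simp add: inverse_eq_divide)
    then have "(\<lambda>k. ennreal ((c + 1 / Suc k) * w x)) \<longlonglongrightarrow> ennreal (c * w x)"
      by (intro tendsto_ennrealI) simp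
    then show ?case
      by (rule LIMSEQ_le_const) (use elim in blast)
  qed
  then show ?thesis
    by (simp add: A1_bounds_def c_def)
qed

end

theory Submission
  imports Defs
begin

text \<open>
  Let \<open>Y\<^sub>n = max\<^bsub>k \<le> n\<^esub> |f\<^sub>k|\<close> and let \<open>V\<^sub>n\<close> be the running maximum of \<open>E(w | F\<^sub>n)\<close>. The process
  \<open>(3 Y\<^sub>n + |f\<^sub>n|\<^sup>2 / Y\<^sub>n) V\<^sub>n\<close> lies between \<open>0\<close> and \<open>4 Y\<^sub>n V\<^sub>n\<close>, and its increments dominate
  \<open>|df\<^sub>n|\<^sup>2 / Y\<^sub>n * V\<^sub>n\<close> up to a martingale difference. As \<open>E(w | F\<^sub>n) \<le> V\<^sub>n \<le> [w] w\<close>, summation gives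
  \<open>E (\<Sum>\<^sub>n |df\<^sub>n|\<^sup>2 / Y\<^sub>n) w \<le> 4 [w] E Y\<^sub>N w\<close>. Finally
  \<open>\<Sum>\<^sub>n |df\<^sub>n|\<^sup>2 \<le> (\<Sum>\<^sub>n |df\<^sub>n|\<^sup>2 / Y\<^sub>n) Y\<^sub>N\<close>, and the arithmetic-geometric mean inequality with weight
  \<open>[w]\<^sup>1\<^sup>/\<^sup>2\<close> splits the square root of the right-hand side.
\<close>

subsection \<open>Strong integrals\<close>

lemma simple_function_imp_measurable_count_space:
  assumes "simple_function M s"
  shows "s \<in> measurable M (count_space (s ` space M))"
  using assms by (subst measurable_count_space_eq2) (auto simp: simple_function_def)

text \<open>In a nonseparable space the difference of two Borel functions can fail to be measurable.
  Here \<open>s\<close> takes only finitely many values, and for each fixed value the norm of the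
  difference is a continuous function of \<open>f x\<close>.\<close>

lemma borel_measurable_norm_diff_simple:
  fixes f :: "'a \<Rightarrow> 'b::real_normed_vector"
  assumes f: "f \<in> borel_measurable M" and s: "simple_function M s"
  shows "(\<lambda>x. norm (f x - s x)) \<in> borel_measurable M"
proof (rule measurable_compose_countable'[where f = "\<lambda>z x. norm (f x - z)" and g = s])
  show "s \<in> measurable M (count_space (s ` space M))"
    by (rule simple_function_imp_measurable_count_space[OF s])
  show "countable (s ` space M)"
    using s by (auto simp: simple_function_def intro: countable_finite)
  show "(\<lambda>x. norm (f x - z)) \<in> borel_measurable M" for z
    by (rule borel_measurable_continuous_on[OF _ f]) (intro continuous_intros)
qed

text \<open>Boundedness of \<open>T\<close> carries the approximation in mean of \<open>f\<close> by
  \<open>s i\<close> over to \<open>T (f x)\<close> and \<open>T (s i x)\<close>. With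
  \<open>T\<close> an inner product against a fixed vector, questions about the strong integral
  reduce to real integrals.\<close>

lemma has_bochner_integral_bounded_linear_strong:
  fixes T :: "'b::banach \<Rightarrow> 'c::{banach, second_countable_topology}"
  assumes T: "bounded_linear T" and f: "has_strong_integral M f a"
  shows "has_bochner_integral M (\<lambda>x. T (f x)) (T a)"
  using f
proof cases
  case (1 s)
  interpret T: bounded_linear T by fact
  obtain K where K: "0 \<le> K" "\<And>x. norm (T x) \<le> norm x * K"
    using T.nonneg_bounded by blast
  have sf: "simple_function M (s i)" for i
    using 1(2) by (auto elim: simple_bochner_integrable.cases)
  show ?thesis
  proof (rule has_bochner_integral.intros)
    show "(\<lambda>x. T (f x)) \<in> borel_measurable M"
      by (rule borel_measurable_continuous_on[OF _ 1(1)]) (intro T.continuous_on continuous_on_id)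
    show "Bochner_Integration.simple_bochner_integrable M (\<lambda>x. T (s i x))" for i
      using simple_bochner_integrable_compose2[where p = "\<lambda>x y. T x", OF _ 1(2) 1(2)] T.zero
      by simp
    have le: "(\<integral>\<^sup>+x. ennreal (norm (T (f x) - T (s i x))) \<partial>M)
        \<le> ennreal K * (\<integral>\<^sup>+x. ennreal (norm (f x - s i x)) \<partial>M)" for i
    proof -
      have "(\<integral>\<^sup>+x. ennreal (norm (T (f x) - T (s i x))) \<partial>M)
          \<le> (\<integral>\<^sup>+x. ennreal K * ennreal (norm (f x - s i x)) \<partial>M)"
        using K by (intro nn_integral_mono)
          (simp add: T.diff[symmetric] ennreal_mult''[symmetric] mult.commute ennreal_leI)
      also have "\<dots> = ennreal K * (\<integral>\<^sup>+x. ennreal (norm (f x - s i x)) \<partial>M)"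
        using borel_measurable_norm_diff_simple[OF 1(1) sf] by (intro nn_integral_cmult) simp
      finally show ?thesis .
    qed
    have "(\<lambda>i. ennreal K * (\<integral>\<^sup>+x. ennreal (norm (f x - s i x)) \<partial>M)) \<longlonglongrightarrow> ennreal K * 0"
      by (rule ennreal_tendsto_cmult) (simp_all add: 1(3))
    then have "(\<lambda>i. ennreal K * (\<integral>\<^sup>+x. ennreal (norm (f x - s i x)) \<partial>M)) \<longlonglongrightarrow> 0"
      by simp
    then show "(\<lambda>i. \<integral>\<^sup>+x. ennreal (norm (T (f x) - T (s i x))) \<partial>M) \<longlonglongrightarrow> 0"
      by (rule tendsto_sandwich[OF _ _ tendsto_const, rotated 2])
        (rule always_eventually, rule allI, rule zero_le le)+
    have "(\<lambda>i. T (Bochner_Integration.simple_bochner_integral M (s i))) \<longlonglongrightarrow> T a"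
      by (rule T.tendsto[OF 1(4)])
    then show "(\<lambda>i. Bochner_Integration.simple_bochner_integral M (\<lambda>x. T (s i x))) \<longlonglongrightarrow> T a"
      by (simp add: simple_bochner_integral_linear[OF T.linear 1(2)])
  qed
qed

text \<open>Real integrals against every vector \<open>z\<close> are unique, and inner products
  separate points. This resolves the definite description in \<open>strong_integral\<close>.\<close>

lemma has_strong_integral_unique:
  fixes f :: "'a \<Rightarrow> 'b::{real_inner, banach}"
  assumes "has_strong_integral M f a" "has_strong_integral M f b"
  shows "a = b"
proof -
  have "inner z a = inner z b" for z
    using assms[THEN has_bochner_integral_bounded_linear_strong[OF bounded_linear_inner_right]]
    by (rule has_bochner_integral_eq)
  then show ?thesis
    by (metis inner_commute vector_eq_rdot)
qed

lemma has_bochner_integral_inner_strong: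
  fixes f :: "'a \<Rightarrow> 'b::{real_inner, banach}"
  assumes "strongly_integrable M f"
  shows "has_bochner_integral M (\<lambda>x. inner z (f x)) (inner z (strong_integral M f))"
proof -
  obtain a where a: "has_strong_integral M f a"
    using assms by (auto simp: strongly_integrable_def)
  have "(THE a. has_strong_integral M f a) = a"
    by (rule the_equality) (use a has_strong_integral_unique in blast)+
  with a show ?thesis
    using has_bochner_integral_bounded_linear_strong[OF bounded_linear_inner_right a] assms
    by (simp add: strong_integral_def)
qed

text \<open>The triangle inequality passes through \<open>f\<close>. This turns approximation in
  mean into the Cauchy property of the integrals.\<close>

lemma simple_bochner_integral_diff_bound:
  fixes f :: "'a \<Rightarrow> 'b::real_normed_vector"
  assumes f: "f \<in> borel_measurable M"
    and s: "Bochner_Integration.simple_bochner_integrable M s"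
    and t: "Bochner_Integration.simple_bochner_integrable M t"
  shows "ennreal (norm (Bochner_Integration.simple_bochner_integral M s
      - Bochner_Integration.simple_bochner_integral M t))
    \<le> (\<integral>\<^sup>+x. ennreal (norm (f x - s x)) \<partial>M) + (\<integral>\<^sup>+x. ennreal (norm (f x - t x)) \<partial>M)"
proof -
  have sf: "simple_function M s" "simple_function M t"
    using s t by (auto elim: simple_bochner_integrable.cases)
  note [measurable] = sf[THEN borel_measurable_norm_diff_simple[OF f]]
  have "ennreal (norm (Bochner_Integration.simple_bochner_integral M s
      - Bochner_Integration.simple_bochner_integral M t))
    = norm (Bochner_Integration.simple_bochner_integral M (\<lambda>x. s x - t x))"
    using s t by (subst simple_bochner_integral_diff) auto
  also have "\<dots> \<le> Bochner_Integration.simple_bochner_integral M (\<lambda>x. norm (s x - t x))"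
    using simple_bochner_integrable_compose2[of "(-)" M s t] s t
    by (auto intro!: simple_bochner_integral_norm_bound ennreal_leI)
  also have "\<dots> = (\<integral>\<^sup>+x. norm (s x - t x) \<partial>M)"
    using simple_bochner_integrable_compose2[of "\<lambda>x y. norm (x - y)" M s t] s t
    by (auto intro!: simple_bochner_integral_eq_nn_integral)
  also have "\<dots> \<le> (\<integral>\<^sup>+x. ennreal (norm (f x - s x)) + ennreal (norm (f x - t x)) \<partial>M)"
  proof (rule nn_integral_mono)
    fix x
    have "norm (s x - t x) \<le> norm (f x - s x) + norm (f x - t x)"
      by (metis dual_order.refl norm_diff_triangle_le norm_minus_commute)
    then show "ennreal (norm (s x - t x)) \<le> ennreal (norm (f x - s x)) + ennreal (norm (f x - t x))"
      by (metis ennreal_leI ennreal_plus norm_ge_zero)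
  qed
  also have "\<dots> = (\<integral>\<^sup>+x. ennreal (norm (f x - s x)) \<partial>M) + (\<integral>\<^sup>+x. ennreal (norm (f x - t x)) \<partial>M)"
    by (rule nn_integral_add) auto
  finally show ?thesis .
qed

text \<open>Completeness supplies the limit of the integrals of the \<open>s i\<close>, so only
  approximation in mean of a Borel function has to be checked.\<close>

lemma strongly_integrableI_sequence:
  fixes f :: "'a \<Rightarrow> 'b::banach"
  assumes f: "f \<in> borel_measurable M"
    and s: "\<And>i. Bochner_Integration.simple_bochner_integrable M (s i)"
    and lim: "(\<lambda>i. \<integral>\<^sup>+x. ennreal (norm (f x - s i x)) \<partial>M) \<longlonglongrightarrow> 0"
  shows "strongly_integrable M f"
proof -
  let ?S = "\<lambda>i. \<integral>\<^sup>+x. ennreal (norm (f x - s i x)) \<partial>M"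
  have "Cauchy (\<lambda>i. Bochner_Integration.simple_bochner_integral M (s i))"
  proof (rule metric_CauchyI)
    fix e :: real assume "0 < e"
    then have "0 < ennreal (e / 2)" by auto
    from order_tendstoD(2)[OF lim this]
    obtain n0 where n0: "\<And>n. n0 \<le> n \<Longrightarrow> ?S n < e / 2"
      by (auto simp: eventually_sequentially)
    have "dist (Bochner_Integration.simple_bochner_integral M (s m))
        (Bochner_Integration.simple_bochner_integral M (s n)) < e" if "n0 \<le> m" "n0 \<le> n" for m n
    proof -
      have "ennreal (norm (Bochner_Integration.simple_bochner_integral M (s m)
          - Bochner_Integration.simple_bochner_integral M (s n))) \<le> ?S m + ?S n"
        by (intro simple_bochner_integral_diff_bound s f)
      also have "\<dots> < ennreal (e / 2) + e / 2"
        by (intro add_strict_mono n0 that)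
      also have "\<dots> = e" using \<open>0 < e\<close> by (simp flip: ennreal_plus)
      finally show ?thesis
        using \<open>0 < e\<close> by (simp add: dist_norm ennreal_less_iff)
    qed
    then show "\<exists>n0. \<forall>m\<ge>n0. \<forall>n\<ge>n0. dist (Bochner_Integration.simple_bochner_integral M (s m))
        (Bochner_Integration.simple_bochner_integral M (s n)) < e" by blast
  qed
  then obtain b where "(\<lambda>i. Bochner_Integration.simple_bochner_integral M (s i)) \<longlonglongrightarrow> b"
    by (auto simp: Cauchy_convergent_iff convergent_def)
  then show ?thesis
    unfolding strongly_integrable_def using f s lim by (blast intro: has_strong_integral.intros)
qed

text \<open>Cutting the approximants of \<open>f\<close> down to \<open>A\<close> keeps them simple
  and does not increase the error in mean.\<close>

lemma strongly_integrable_indicator: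
  fixes f :: "'a \<Rightarrow> 'b::banach"
  assumes f: "strongly_integrable M f" and A: "A \<in> sets M"
  shows "strongly_integrable M (\<lambda>x. indicator A x *\<^sub>R f x)"
proof -
  obtain a where "has_strong_integral M f a"
    using f by (auto simp: strongly_integrable_def)
  then show ?thesis
  proof cases
    case (1 s)
    have sf: "simple_function M (s i)" for i
      using 1(2) by (auto elim: simple_bochner_integrable.cases)
    have fA: "(\<lambda>x. indicator A x *\<^sub>R f x) \<in> borel_measurable M"
    proof -
      have "(\<lambda>x. if x \<in> A then f x else 0) \<in> borel_measurable M"
        using A 1(1) by (intro measurable_If_set) auto
      then show ?thesis
        by (rule measurable_cong[THEN iffD1, rotated]) simp
    qed
    define t where "t i x = indicat_real A x *\<^sub>R s i x" for i x
    have t: "Bochner_Integration.simple_bochner_integrable M (t i)" for i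
    proof
      show "simple_function M (t i)"
        unfolding t_def using A sf
        by (intro simple_function_compose2[where h = "\<lambda>r x. r *\<^sub>R x"] simple_function_indicator) auto
      have fin: "emeasure M {x \<in> space M. s i x \<noteq> 0} < \<infinity>"
        using 1(2)[of i] by cases (simp add: top.not_eq_extremum)
      have "emeasure M {x \<in> space M. t i x \<noteq> 0} \<le> emeasure M {x \<in> space M. s i x \<noteq> 0}"
      proof (rule emeasure_mono)
        have "s i \<in> measurable M (count_space UNIV)"
          by (rule measurable_simple_function[OF sf])
        then show "{x \<in> space M. s i x \<noteq> 0} \<in> sets M"
          by measurable
      qed (auto simp: t_def)
      with fin show "emeasure M {x \<in> space M. t i x \<noteq> 0} \<noteq> \<infinity>"
        by (auto simp: top_unique)
    qed
    have lim: "(\<lambda>i. \<integral>\<^sup>+x. ennreal (norm (indicator A x *\<^sub>R f x - t i x)) \<partial>M) \<longlonglongrightarrow> 0"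
    proof (rule tendsto_sandwich[OF _ _ tendsto_const 1(3)])
      show "\<forall>\<^sub>F i in sequentially. (\<integral>\<^sup>+x. ennreal (norm (indicator A x *\<^sub>R f x - t i x)) \<partial>M)
          \<le> (\<integral>\<^sup>+x. ennreal (norm (f x - s i x)) \<partial>M)"
        by (intro always_eventually allI nn_integral_mono)
          (auto simp: t_def split: split_indicator)
    qed simp
    show ?thesis
      by (rule strongly_integrableI_sequence[OF fA t lim])
  qed
qed

text \<open>The values of all approximants form a countable set \<open>D\<close>. The distance from
  \<open>f x\<close> to \<open>D\<close> is at most \<open>norm (f x - s i x)\<close> for every
  \<open>i\<close>, so its integral is 0; it is measurable because it is continuous in
  \<open>f x\<close>.\<close>

lemma AE_in_closure_countable_strong:
  fixes f :: "'a \<Rightarrow> 'b::banach"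
  assumes "strongly_integrable M f"
  obtains D where "countable D" "0 \<in> D" "AE x in M. f x \<in> closure D"
proof -
  obtain a where "has_strong_integral M f a"
    using assms by (auto simp: strongly_integrable_def)
  then show ?thesis
  proof cases
    case (1 s)
    define D where "D = insert 0 (\<Union>i. s i ` space M)"
    have "simple_function M (s i)" for i
      using 1(2)[of i] by cases
    then have "countable D"
      by (auto simp: D_def simple_function_def intro: countable_finite)
    have [measurable]: "(\<lambda>x. infdist (f x) D) \<in> borel_measurable M"
      by (rule borel_measurable_continuous_on[OF _ 1(1)]) (intro continuous_intros)
    have "(\<integral>\<^sup>+x. ennreal (infdist (f x) D) \<partial>M) \<le> (\<integral>\<^sup>+x. ennreal (norm (f x - s i x)) \<partial>M)" for i
    proof (rule nn_integral_mono)
      fix x assume "x \<in> space M"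
      then have "infdist (f x) D \<le> dist (f x) (s i x)"
        by (intro infdist_le) (auto simp: D_def)
      then show "ennreal (infdist (f x) D) \<le> ennreal (norm (f x - s i x))"
        by (simp add: dist_norm ennreal_leI)
    qed
    then have "(\<integral>\<^sup>+x. ennreal (infdist (f x) D) \<partial>M) \<le> 0"
      by (intro LIMSEQ_le_const[OF 1(3)]) auto
    then have "AE x in M. ennreal (infdist (f x) D) = 0"
      by (simp add: nn_integral_0_iff_AE)
    then have "AE x in M. f x \<in> closure D"
    proof eventually_elim
      case (elim x)
      then have "infdist (f x) D = 0"
        by (simp add: ennreal_eq_0_iff infdist_nonneg antisym)
      then show ?case
        by (subst in_closure_iff_infdist_zero) (auto simp: D_def)
    qed
    then show ?thesis
      using \<open>countable D\<close> by (intro that[of D]) (auto simp: D_def)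
  qed
qed

subsection \<open>Separable approximation and orthogonality\<close>

text \<open>The error is relative to \<open>norm (u x)\<close> so that the approximants of an unbounded \<open>u\<close> are
  dominated by \<open>2 * norm (u x)\<close>; this is what \<open>0 \<in> D\<close> is for.\<close>

lemma measurable_countable_approx:
  fixes u :: "'a \<Rightarrow> 'b::real_normed_vector"
  assumes D: "countable D" "0 \<in> D"
    and u: "u \<in> borel_measurable M" "\<And>x. x \<in> space M \<Longrightarrow> u x \<in> closure D"
    and e: "0 < e"
  obtains J :: "'a \<Rightarrow> nat" where "J \<in> measurable M (count_space UNIV)"
    "\<And>x. x \<in> space M \<Longrightarrow> norm (u x - from_nat_into D (J x)) \<le> e * norm (u x)"
proof -
  \<comment> \<open>Taking the least admissible index keeps \<open>J\<close> measurable: its level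
    sets are determined by the measurable distances to the countably many points of
    \<open>D\<close>.\<close>
  define J where "J x = (LEAST j. norm (u x - from_nat_into D j) \<le> e * norm (u x))" for x
  have [measurable]: "(\<lambda>x. norm (u x - z)) \<in> borel_measurable M" "(\<lambda>x. norm (u x)) \<in> borel_measurable M"
    for z
    by (rule borel_measurable_continuous_on[OF _ u(1)], intro continuous_intros)+
  have "J \<in> measurable M (count_space UNIV)"
    unfolding J_def by measurable
  moreover have "norm (u x - from_nat_into D (J x)) \<le> e * norm (u x)" if x: "x \<in> space M" for x
  proof -
    have "\<exists>z\<in>D. norm (u x - z) \<le> e * norm (u x)"
    proof (cases "u x = 0")
      case True
      with D(2) show ?thesis by force
    next
      case False
      then have "0 < e * norm (u x)" using e by simp
      with u(2)[OF x] obtain z where "z \<in> D" "dist z (u x) < e * norm (u x)"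
        by (auto simp: closure_approachable)
      then show ?thesis
        by (auto simp: dist_norm norm_minus_commute intro!: bexI[of _ z])
    qed
    then obtain j where "norm (u x - from_nat_into D j) \<le> e * norm (u x)"
      using D(1) by (metis from_nat_into_surj)
    then show ?thesis
      unfolding J_def by (rule LeastI)
  qed
  ultimately show ?thesis
    by (rule that)
qed

text \<open>The relative errors \<open>inverse (real (Suc k))\<close> tend to 0, which gives the
  limit, and are at most 1, which gives the domination by twice the norm.\<close>

lemma measurable_countable_approx_seq:
  fixes u :: "'a \<Rightarrow> 'b::real_normed_vector"
  assumes D: "countable D" "0 \<in> D"
    and u: "u \<in> borel_measurable M" "\<And>x. x \<in> space M \<Longrightarrow> u x \<in> closure D"
  obtains J :: "nat \<Rightarrow> 'a \<Rightarrow> nat" where "\<And>k. J k \<in> measurable M (count_space UNIV)"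
    "\<And>k x. x \<in> space M \<Longrightarrow> norm (from_nat_into D (J k x)) \<le> 2 * norm (u x)"
    "\<And>x. x \<in> space M \<Longrightarrow> (\<lambda>k. from_nat_into D (J k x)) \<longlonglongrightarrow> u x"
proof -
  have "\<exists>J. J \<in> measurable M (count_space UNIV) \<and>
      (\<forall>x\<in>space M. norm (u x - from_nat_into D (J x)) \<le> inverse (real (Suc k)) * norm (u x))" for k
    by (rule measurable_countable_approx[OF D u, of "inverse (real (Suc k))"]) auto
  then obtain J :: "nat \<Rightarrow> 'a \<Rightarrow> nat" where J: "\<And>k. J k \<in> measurable M (count_space UNIV)"
    "\<And>k x. x \<in> space M \<Longrightarrow>
      norm (u x - from_nat_into D (J k x)) \<le> inverse (real (Suc k)) * norm (u x)"
    by metis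
  show ?thesis
  proof
    show "J k \<in> measurable M (count_space UNIV)" for k by (rule J)
    show "norm (from_nat_into D (J k x)) \<le> 2 * norm (u x)" if x: "x \<in> space M" for k x
    proof -
      have "inverse (real (Suc k)) * norm (u x) \<le> 1 * norm (u x)"
        by (intro mult_right_mono) (auto simp: field_simps)
      then show ?thesis
        using J(2)[OF x, of k] norm_triangle_sub[of "from_nat_into D (J k x)" "u x"]
        by (simp add: norm_minus_commute)
    qed
    show "(\<lambda>k. from_nat_into D (J k x)) \<longlonglongrightarrow> u x" if x: "x \<in> space M" for x
    proof (rule LIM_zero_cancel, rule Lim_null_comparison)
      show "\<forall>\<^sub>F k in sequentially. norm (from_nat_into D (J k x) - u x)
          \<le> inverse (real (Suc k)) * norm (u x)"
        using J(2)[OF x] by (simp add: norm_minus_commute)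
      show "(\<lambda>k. inverse (real (Suc k)) * norm (u x)) \<longlonglongrightarrow> 0"
        by (intro tendsto_mult_left_zero LIMSEQ_inverse_real_of_nat)
    qed
  qed
qed

text \<open>In a nonseparable space the inner product of two Borel functions can fail to be
  measurable. The approximants of \<open>u\<close> take countably many values, and on each of their
  level sets the inner product is one with a fixed vector, so weak measurability of \<open>d\<close>
  suffices.\<close>

lemma borel_measurable_inner_countable_closure:
  fixes u :: "'a \<Rightarrow> 'b::real_inner"
  assumes D: "countable D" "0 \<in> D"
    and u: "u \<in> borel_measurable M" "\<And>x. x \<in> space M \<Longrightarrow> u x \<in> closure D"
    and d: "\<And>z. (\<lambda>x. inner z (d x)) \<in> borel_measurable M"
  shows "(\<lambda>x. inner (u x) (d x)) \<in> borel_measurable M"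
proof -
  obtain J :: "nat \<Rightarrow> 'a \<Rightarrow> nat" where J: "\<And>k. J k \<in> measurable M (count_space UNIV)"
    "\<And>x. x \<in> space M \<Longrightarrow> (\<lambda>k. from_nat_into D (J k x)) \<longlonglongrightarrow> u x"
    using measurable_countable_approx_seq[OF D u] by metis
  show ?thesis
  proof (rule borel_measurable_LIMSEQ_real)
    show "(\<lambda>x. inner (from_nat_into D (J k x)) (d x)) \<in> borel_measurable M" for k
      by (rule measurable_compose_countable[OF d J(1)])
    show "(\<lambda>k. inner (from_nat_into D (J k x)) (d x)) \<longlonglongrightarrow> inner (u x) (d x)"
      if "x \<in> space M" for x
      by (intro tendsto_inner tendsto_const J(2) that)
  qed
qed

text \<open>The assumption on \<open>g\<close> says that its conditional expectation given
  \<open>F\<close> vanishes, and the \<open>F\<close>-measurable factor \<open>c\<close> can be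
  taken out.\<close>

lemma (in sigma_finite_subalgebra) integral_mult_eq_0:
  fixes g :: "'a \<Rightarrow> real"
  assumes g: "integrable M g" "\<And>A. A \<in> sets F \<Longrightarrow> (\<integral>x\<in>A. g x \<partial>M) = 0"
    and c: "c \<in> borel_measurable F" "integrable M (\<lambda>x. c x * g x)"
  shows "(\<integral>x. c x * g x \<partial>M) = 0"
proof -
  have "AE x in M. real_cond_exp M F g x = 0"
    using g by (intro real_cond_exp_charact) (auto simp: set_lebesgue_integral_def)
  then have "(\<integral>x. c x * real_cond_exp M F g x \<partial>M) = (\<integral>x. 0 \<partial>M)"
    using measurable_from_subalg[OF subalg c(1)] by (intro integral_cong_AE) auto
  then show ?thesis
    using real_cond_exp_intg(2)[OF c(2,1)] g(1) by simp
qed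

text \<open>This is the orthogonality of a martingale difference \<open>d\<close> to the
  \<open>F\<close>-measurable vector field \<open>c u\<close>. Countably valued approximants of
  \<open>u\<close> reduce it to real multipliers on level sets, and domination by
  \<open>2 * B\<close> permits the passage to the limit.\<close>

lemma (in sigma_finite_subalgebra) integral_inner_eq_0:
  fixes u d :: "'a \<Rightarrow> 'b::real_inner"
  assumes D: "countable D" "0 \<in> D"
    and u: "u \<in> borel_measurable F" "\<And>x. x \<in> space M \<Longrightarrow> u x \<in> closure D"
    and c: "c \<in> borel_measurable F"
    and d: "\<And>z. integrable M (\<lambda>x. inner z (d x))"
      "\<And>z A. A \<in> sets F \<Longrightarrow> (\<integral>x\<in>A. inner z (d x) \<partial>M) = 0"
    and B: "integrable M B" "AE x in M. \<bar>c x\<bar> * norm (u x) * norm (d x) \<le> B x"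
  shows "(\<integral>x. c x * inner (u x) (d x) \<partial>M) = 0"
proof -
  let ?e = "from_nat_into D"
  have spF: "space F = space M"
    using subalg by (simp add: subalgebra_def)
  note [measurable] = c measurable_from_subalg[OF subalg c] borel_measurable_integrable[OF d(1)]
  have uM: "u \<in> borel_measurable M"
    by (rule measurable_from_subalg[OF subalg u(1)])
  obtain J :: "nat \<Rightarrow> 'a \<Rightarrow> nat" where J: "\<And>k. J k \<in> measurable F (count_space UNIV)"
    "\<And>k x. x \<in> space M \<Longrightarrow> norm (?e (J k x)) \<le> 2 * norm (u x)"
    "\<And>x. x \<in> space M \<Longrightarrow> (\<lambda>k. ?e (J k x)) \<longlonglongrightarrow> u x"
    using measurable_countable_approx_seq[OF D u(1)] u(2) spF by metis
  note [measurable] = J(1) J(1)[THEN measurable_from_subalg[OF subalg]]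
  have [measurable]: "(\<lambda>x. inner (?e (J k x)) (d x)) \<in> borel_measurable M" for k
    by (rule measurable_compose_countable[where f = "\<lambda>j x. inner (?e j) (d x)"]) measurable
  have [measurable]: "(\<lambda>x. inner (u x) (d x)) \<in> borel_measurable M"
    by (rule borel_measurable_inner_countable_closure[OF D uM u(2)]) measurable
  have bound: "AE x in M. norm (c x * inner (?e (J k x)) (d x)) \<le> 2 * B x" for k
    using B(2) AE_space
  proof eventually_elim
    case (elim x)
    have "norm (c x * inner (?e (J k x)) (d x)) \<le> \<bar>c x\<bar> * (norm (?e (J k x)) * norm (d x))"
      by (simp add: abs_mult mult_left_mono Cauchy_Schwarz_ineq2)
    also have "\<dots> \<le> \<bar>c x\<bar> * (2 * norm (u x) * norm (d x))"
      using J(2)[OF elim(2)] by (intro mult_left_mono mult_right_mono) auto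
    finally show ?case
      using elim(1) by (simp add: algebra_simps)
  qed
  have int: "integrable M (\<lambda>x. c x * inner (?e (J k x)) (d x))" for k
  proof (rule Bochner_Integration.integrable_bound)
    show "integrable M (\<lambda>x. 2 * B x)" using B(1) by simp
    show "AE x in M. norm (c x * inner (?e (J k x)) (d x)) \<le> norm (2 * B x)"
      using bound[of k] by eventually_elim simp
  qed measurable
  have zero: "(\<integral>x. c x * inner (?e (J k x)) (d x) \<partial>M) = 0" for k
  proof -
    define A where "A j = J k -` {j} \<inter> space M" for j
    have AF: "A j \<in> sets F" for j
      unfolding A_def spF[symmetric] by (rule measurable_sets[OF J(1)]) simp
    have AM [measurable]: "A j \<in> sets M" for j
      using AF subalg by (auto simp: subalgebra_def)
    have un: "(\<Union>j. A j) = space M"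
      by (auto simp: A_def)
    have "(\<integral>x. c x * inner (?e (J k x)) (d x) \<partial>M)
        = (\<integral>x\<in>(\<Union>j. A j). c x * inner (?e (J k x)) (d x) \<partial>M)"
      unfolding un by (rule set_integral_space[OF int, symmetric])
    also have "\<dots> = (\<Sum>j. (\<integral>x\<in>A j. c x * inner (?e (J k x)) (d x) \<partial>M))"
    proof (rule lebesgue_integral_countable_add)
      show "set_integrable M (\<Union>j. A j) (\<lambda>x. c x * inner (?e (J k x)) (d x))"
        unfolding set_integrable_def by (intro integrable_mult_indicator int) measurable
    qed (auto simp: A_def)
    also have "\<dots> = 0"
    proof -
      have "(\<integral>x\<in>A j. c x * inner (?e (J k x)) (d x) \<partial>M) = 0" for j
      proof -
        \<comment> \<open>On \<open>A j\<close> the index \<open>J k x\<close> is the constant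
          \<open>j\<close>, so the approximant becomes a fixed vector and the scalar orthogonality
          applies with multiplier \<open>indicator (A j) x * c x\<close>.\<close>
        have eq: "indicator (A j) x *\<^sub>R (c x * inner (?e (J k x)) (d x))
            = (indicator (A j) x * c x) * inner (?e j) (d x)" for x
          by (auto simp: A_def split: split_indicator)
        have "integrable M (\<lambda>x. (indicator (A j) x * c x) * inner (?e j) (d x))"
          unfolding eq[symmetric] by (intro integrable_mult_indicator int AM)
        then have "(\<integral>x. (indicator (A j) x * c x) * inner (?e j) (d x) \<partial>M) = 0"
          using AF[of j] c by (intro integral_mult_eq_0 d) auto
        then show ?thesis
          unfolding set_lebesgue_integral_def eq .
      qed
      then show ?thesis by simp
    qed
    finally show ?thesis .
  qed
  have "(\<lambda>k. \<integral>x. c x * inner (?e (J k x)) (d x) \<partial>M) \<longlonglongrightarrow> (\<integral>x. c x * inner (u x) (d x) \<partial>M)"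
  proof (rule integral_dominated_convergence[where w = "\<lambda>x. 2 * B x"])
    show "AE x in M. (\<lambda>k. c x * inner (?e (J k x)) (d x)) \<longlonglongrightarrow> c x * inner (u x) (d x)"
      using AE_space by eventually_elim (intro tendsto_intros J(3))
  qed (use B(1) bound in auto)
  then show ?thesis
    unfolding zero by (simp add: LIMSEQ_const_iff)
qed

subsection \<open>The Davis inequality with a monotone weight\<close>

text \<open>Expanding \<open>norm x'\<close> squared rewrites the inner product through the three
  squared norms. The growth from \<open>y\<close> to \<open>y'\<close> is absorbed at fixed weight
  in \<open>conv\<close>; then \<open>v\<close> is raised to \<open>v'\<close>. The inner product
  term is the one that has integral 0 along a martingale.\<close>

lemma davis_step:
  fixes x x' :: "'b::real_inner" and y v v' :: real
  assumes xy: "norm x \<le> y" and v: "0 \<le> v" "v \<le> v'"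
  defines "y' \<equiv> max y (norm x')"
  shows "v * (3 * y + (norm x)\<^sup>2 / y) + 2 * v / y * inner x (x' - x) + v' * ((norm (x' - x))\<^sup>2 / y')
    \<le> v' * (3 * y' + (norm x')\<^sup>2 / y')"
proof -
  define a b h where "a = norm x" and "b = norm x'" and "h = norm (x' - x)"
  have h1: "h \<le> a + b" and h2: "b - a \<le> h"
    unfolding a_def b_def h_def by norm+
  have nn: "0 \<le> a" "0 \<le> b" "0 \<le> h" "a \<le> y"
    using xy by (auto simp: a_def b_def h_def)
  have y': "y' = max y b"
    by (simp add: y'_def b_def)
  have yy: "y \<le> y'" "b \<le> y'" "0 \<le> y'"
    using y' nn by auto
  have ip: "2 * inner x (x' - x) = b\<^sup>2 - a\<^sup>2 - h\<^sup>2"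
    by (simp add: a_def b_def h_def power2_norm_eq_inner inner_diff_left inner_diff_right
        inner_commute)
  \<comment> \<open>By \<open>jump\<close> the bracket multiplying \<open>v'\<close> is nonnegative, so \<open>v'\<close> may be lowered to \<open>v\<close>.\<close>
  have jump: "h\<^sup>2 / y' \<le> 3 * y' + b\<^sup>2 / y'"
  proof (cases "y' = 0")
    case False
    have "h\<^sup>2 \<le> (y' + b)\<^sup>2"
      using h1 nn yy by (intro power_mono) auto
    \<comment> \<open>The coefficient 3 comes from here: \<open>b \<le> y'\<close> bounds the cross
      term \<open>2 * y' * b\<close> by twice the square of \<open>y'\<close>.\<close>
    also have "\<dots> \<le> 3 * y'\<^sup>2 + b\<^sup>2"
      using mult_left_mono[OF yy(2,3)] by (simp add: power2_eq_square algebra_simps)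
    finally have "h\<^sup>2 / y' \<le> (3 * y'\<^sup>2 + b\<^sup>2) / y'"
      using yy by (intro divide_right_mono) auto
    also have "\<dots> = 3 * y' + b\<^sup>2 / y'"
      using False by (simp add: add_divide_distrib power2_eq_square)
    finally show ?thesis .
  qed simp
  have conv: "3 * y + a\<^sup>2 / y + (b\<^sup>2 - a\<^sup>2 - h\<^sup>2) / y \<le> 3 * y' + b\<^sup>2 / y' - h\<^sup>2 / y'"
  proof (cases "y = 0")
    \<comment> \<open>With \<open>y = 0\<close> also \<open>a = 0\<close>, hence
      \<open>h = b\<close>. Division by zero gives 0, so the left side vanishes and the right side
      is \<open>3 * y'\<close>.\<close>
    case True
    then have "h = b"
      using nn h1 h2 by simp
    with True show ?thesis
      using yy by simp
  next
    case False
    then have y: "0 < y" using nn by simp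
    have lhs: "3 * y + a\<^sup>2 / y + (b\<^sup>2 - a\<^sup>2 - h\<^sup>2) / y = 3 * y + (b\<^sup>2 - h\<^sup>2) / y"
      by (simp add: diff_divide_distrib)
    show ?thesis
    proof (cases "b \<le> y")
      case True
      then show ?thesis
        unfolding lhs using y' by (simp add: diff_divide_distrib)
    next
      case False
      then have b: "y < b" "y' = b" using y' by auto
      \<comment> \<open>After multiplication by \<open>y * b\<close>, the right side minus the left
        side equals the gap in this estimate times \<open>b - y\<close>, plus
        \<open>y * (b\<^sup>2 - y\<^sup>2)\<close>. Both terms are nonnegative.\<close>
      have "(b - y)\<^sup>2 \<le> h\<^sup>2"
        using h2 nn b by (intro power_mono) auto
      then have "(b - y)\<^sup>2 * (b - y) \<le> h\<^sup>2 * (b - y)"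
        using b by (intro mult_right_mono) auto
      moreover have "0 \<le> y * (b\<^sup>2 - y\<^sup>2)"
        using y b by (simp add: power_mono)
      ultimately have "3 * y\<^sup>2 * b + (b\<^sup>2 - h\<^sup>2) * b + h\<^sup>2 * y \<le> 4 * b\<^sup>2 * y"
        by (simp add: power2_eq_square algebra_simps)
      then have "3 * y + (b\<^sup>2 - h\<^sup>2) / y + h\<^sup>2 / b \<le> 4 * b"
        using y b by (simp add: field_simps power2_eq_square)
      moreover have "b\<^sup>2 / b = b"
        using y b by (simp add: power2_eq_square)
      ultimately show ?thesis
        unfolding lhs b(2) by simp
    qed
  qed
  have "v * (3 * y + (norm x)\<^sup>2 / y) + 2 * v / y * inner x (x' - x)
      = v * (3 * y + a\<^sup>2 / y + (2 * inner x (x' - x)) / y)"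
    by (simp add: a_def algebra_simps)
  also have "\<dots> \<le> v * (3 * y' + b\<^sup>2 / y' - h\<^sup>2 / y')"
    unfolding ip using conv v by (intro mult_left_mono) auto
  also have "\<dots> \<le> v' * (3 * y' + b\<^sup>2 / y' - h\<^sup>2 / y')"
    using jump v by (intro mult_right_mono) auto
  finally show ?thesis
    by (simp add: b_def h_def algebra_simps)
qed

section \<open>Running maxima along a filtration\<close>

primrec running_max :: "(nat \<Rightarrow> 'a \<Rightarrow> real) \<Rightarrow> nat \<Rightarrow> 'a \<Rightarrow> real" where
  "running_max p 0 = p 0"
| "running_max p (Suc n) = (\<lambda>x. max (running_max p n x) (p (Suc n) x))"

lemma running_max_mono: "m \<le> n \<Longrightarrow> running_max p m x \<le> running_max p n x"
  by (induction n rule: dec_induct) (auto simp: le_max_iff_disj)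

lemma le_running_max: "p n x \<le> running_max p n x"
  by (cases n) auto

lemma running_max_le: "(\<And>n. p n x \<le> b) \<Longrightarrow> running_max p n x \<le> b"
  by (induction n) auto

lemma borel_measurable_filtration_mono:
  assumes "filtration \<Omega> F" "m \<le> n" "f \<in> borel_measurable (F m)"
  shows "f \<in> borel_measurable (F n)"
proof (rule measurable_from_subalg[OF _ assms(3)])
  show "subalgebra (F n) (F m)"
    using filtration.space_F[OF assms(1)] filtration.sets_F_mono[OF assms(1,2)]
    by (auto simp: subalgebra_def)
qed

lemma borel_measurable_running_max:
  assumes "filtration \<Omega> F" "\<And>n. p n \<in> borel_measurable (F n)"
  shows "running_max p n \<in> borel_measurable (F n)"
proof (induction n)
  case (Suc n)
  have "running_max p n \<in> borel_measurable (F (Suc n))"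
    by (rule borel_measurable_filtration_mono[OF assms(1) _ Suc]) simp
  with assms(2)[of "Suc n"] show ?case by simp
qed (simp add: assms)

text \<open>Polarisation expresses the norm of the difference through two norms and one inner
  product, and the latter is measurable since \<open>u\<close> is separably valued.\<close>

lemma borel_measurable_norm_diff_countable_closure:
  fixes u d :: "'a \<Rightarrow> 'b::real_inner"
  assumes D: "countable D" "0 \<in> D"
    and u: "u \<in> borel_measurable M" "\<And>x. x \<in> space M \<Longrightarrow> u x \<in> closure D"
    and d: "d \<in> borel_measurable M"
  shows "(\<lambda>x. norm (d x - u x)) \<in> borel_measurable M"
proof -
  have "(\<lambda>x. inner z (d x)) \<in> borel_measurable M" for z
    by (rule borel_measurable_continuous_on[OF _ d]) (intro continuous_intros)
  note [measurable] = u(1) d borel_measurable_inner_countable_closure[OF D u this]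
  have "norm (d x - u x) = sqrt ((norm (d x))\<^sup>2 + (norm (u x))\<^sup>2 - 2 * inner (u x) (d x))" for x
    by (simp add: norm_eq_sqrt_inner inner_diff_left inner_diff_right inner_commute)
  then show ?thesis by simp
qed

text \<open>The process \<open>R\<close> telescopes: by \<open>davis_step\<close> its increment
  dominates \<open>T (Suc n)\<close> plus the term \<open>L n\<close>, whose integral is 0. The
  constant 4 is 3 + 1, from \<open>norm (g n x) \<le> Y n x\<close> inserted in
  \<open>R\<close>.\<close>

lemma sum_weighted_differences_le:
  fixes g :: "nat \<Rightarrow> 'a \<Rightarrow> 'b::real_inner" and V :: "nat \<Rightarrow> 'a \<Rightarrow> real"
  assumes M: "finite_measure M" and filt: "filtration (space M) F"
    and sub: "\<And>n. subalgebra M (F n)"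
    and D: "countable D" "0 \<in> D"
    and g: "\<And>n. g n \<in> borel_measurable (F n)" "\<And>n x. g n x \<in> closure D"
      "\<And>n z. integrable M (\<lambda>x. inner z (g n x))"
      "\<And>n z A. A \<in> sets (F n) \<Longrightarrow>
        (\<integral>x\<in>A. inner z (g (Suc n) x) \<partial>M) = (\<integral>x\<in>A. inner z (g n x) \<partial>M)"
    and V: "\<And>n. V n \<in> borel_measurable (F n)" "\<And>n x. 0 \<le> V n x" "\<And>x. incseq (\<lambda>n. V n x)"
  defines "Y \<equiv> running_max (\<lambda>n x. norm (g n x))"
  defines "T \<equiv> \<lambda>n x. V n x * ((norm (g n x - g (n - 1) x))\<^sup>2 / Y n x)"
  assumes int: "integrable M (\<lambda>x. V N x * Y N x)"
  shows "\<And>n. n \<in> {1..N} \<Longrightarrow> integrable M (T n)"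
    and "(\<Sum>n=1..N. (\<integral>x. T n x \<partial>M)) \<le> 4 * (\<integral>x. V N x * Y N x \<partial>M)"
proof -
  interpret finite_measure M by (rule M)
  interpret finite_measure_subalgebra M "F n" for n
    by unfold_locales (rule sub)
  \<comment> \<open>Both factors are nonnegative and nondecreasing in time, so their product at time
    \<open>N\<close> dominates, up to constants, every term at earlier times.\<close>
  define B where "B x = V N x * Y N x" for x
  define R where "R n x = V n x * (3 * Y n x + (norm (g n x))\<^sup>2 / Y n x)" for n x
  define L where "L n x = 2 * V n x / Y n x * inner (g n x) (g (Suc n) x - g n x)" for n x
  have gY: "norm (g n x) \<le> Y n x" for n x
    unfolding Y_def by (rule le_running_max)
  have Y0: "0 \<le> Y n x" for n x
    by (rule order_trans[OF norm_ge_zero gY])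
  have Ymono: "m \<le> n \<Longrightarrow> Y m x \<le> Y n x" for m n x
    unfolding Y_def by (rule running_max_mono)
  have VY: "V m x * Y n x \<le> B x" if "m \<le> N" "n \<le> N" for m n x
    unfolding B_def using incseqD[OF V(3) that(1)] Ymono[OF that(2)] V(2) Y0 by (intro mult_mono)
  have YF: "Y n \<in> borel_measurable (F n)" for n
    unfolding Y_def
    by (intro borel_measurable_running_max[OF filt] measurable_compose[OF g(1) borel_measurable_norm])
  have gM: "g n \<in> borel_measurable M" for n
    by (rule measurable_from_subalg[OF sub g(1)])
  have [measurable]: "V n \<in> borel_measurable M" "Y n \<in> borel_measurable M" for n
    using V(1) YF by (auto intro: measurable_from_subalg[OF sub])
  note [measurable] = gM
  have [measurable]: "(\<lambda>x. norm (g n x - g m x)) \<in> borel_measurable M" for m n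
    by (rule borel_measurable_norm_diff_countable_closure[OF D gM g(2) gM])
  have B: "integrable M B" "integrable M (\<lambda>x. 4 * B x)"
    using int by (auto simp: B_def[abs_def])
  have jump: "norm (g (Suc n) x - g n x) \<le> 2 * Y (Suc n) x" for n x
    using norm_triangle_ineq4[of "g (Suc n) x" "g n x"] gY[of "Suc n" x] gY[of n x]
      Ymono[of n "Suc n" x] by simp
  have T_bound: "0 \<le> T (Suc n) x" "T (Suc n) x \<le> 4 * B x" if n: "Suc n \<le> N" for n x
  proof -
    show "0 \<le> T (Suc n) x"
      using V(2) Y0 by (simp add: T_def)
    have "(norm (g (Suc n) x - g n x))\<^sup>2 / Y (Suc n) x \<le> (2 * Y (Suc n) x)\<^sup>2 / Y (Suc n) x"
      using jump Y0 by (intro divide_right_mono power_mono) auto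
    also have "\<dots> = 4 * Y (Suc n) x"
      by (simp add: power2_eq_square)
    finally have "T (Suc n) x \<le> V (Suc n) x * (4 * Y (Suc n) x)"
      unfolding T_def using V(2) by (intro mult_left_mono) auto
    also have "\<dots> \<le> 4 * B x"
      using VY[OF n n, of x] by simp
    finally show "T (Suc n) x \<le> 4 * B x" .
  qed
  have T_int: "integrable M (T (Suc n))" if n: "Suc n \<le> N" for n
  proof (rule Bochner_Integration.integrable_bound[OF B(2)])
    show "T (Suc n) \<in> borel_measurable M"
      unfolding T_def by measurable
    show "AE x in M. norm (T (Suc n) x) \<le> norm (4 * B x)"
    proof (rule AE_I2)
      show "norm (T (Suc n) x) \<le> norm (4 * B x)" for x
        using T_bound[OF n, of x] by simp
    qed
  qed
  then show "integrable M (T n)" if "n \<in> {1..N}" for n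
    using that by (cases n) auto
  have R_bound: "0 \<le> R n x" "R n x \<le> 4 * B x" if n: "n \<le> N" for n x
  proof -
    show "0 \<le> R n x"
      using V(2) Y0 by (simp add: R_def)
    have "(norm (g n x))\<^sup>2 / Y n x \<le> (Y n x)\<^sup>2 / Y n x"
      using gY Y0 by (intro divide_right_mono power_mono) auto
    also have "\<dots> = Y n x"
      by (simp add: power2_eq_square)
    finally have "R n x \<le> V n x * (4 * Y n x)"
      unfolding R_def using V(2) by (intro mult_left_mono) auto
    also have "\<dots> \<le> 4 * B x"
      using VY[OF n n, of x] by simp
    finally show "R n x \<le> 4 * B x" .
  qed
  have R_int: "integrable M (R n)" if n: "n \<le> N" for n
  proof (rule Bochner_Integration.integrable_bound[OF B(2)])
    show "R n \<in> borel_measurable M"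
      unfolding R_def by measurable
    show "AE x in M. norm (R n x) \<le> norm (4 * B x)"
    proof (rule AE_I2)
      show "norm (R n x) \<le> norm (4 * B x)" for x
        using R_bound[OF n, of x] by simp
    qed
  qed
  \<comment> \<open>The quotient of \<open>norm (g n x)\<close> by \<open>Y n x\<close> is at most
    1, so this term is only linear in the jump. Hence \<open>B\<close> dominates \<open>L n\<close>
    even where jumps are not square integrable.\<close>
  have coeff: "\<bar>2 * V n x / Y n x\<bar> * norm (g n x) * norm (g (Suc n) x - g n x) \<le> 4 * B x"
    if n: "Suc n \<le> N" for n x
  proof -
    have "norm (g n x) / Y n x \<le> 1"
      using gY[of n x] Y0[of n x] by (auto simp: divide_le_eq)
    then have "2 * V n x * (norm (g n x) / Y n x) \<le> 2 * V n x * 1"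
      using V(2) by (intro mult_left_mono) auto
    then have "2 * V n x * (norm (g n x) / Y n x) * norm (g (Suc n) x - g n x)
        \<le> 2 * V n x * 1 * (2 * Y (Suc n) x)"
      by (rule mult_mono[OF _ jump]) (simp_all add: V(2))
    also have "\<dots> \<le> 4 * B x"
      using VY[of n "Suc n" x] n by simp
    finally show ?thesis
      using V(2) Y0 by simp
  qed
  have ing: "(\<lambda>x. inner z (g m x)) \<in> borel_measurable M" for m z
    by (rule borel_measurable_integrable[OF g(3)])
  have L_int: "integrable M (L n)" and L_zero: "(\<integral>x. L n x \<partial>M) = 0" if n: "Suc n \<le> N" for n
  proof -
    show "integrable M (L n)"
    proof (rule Bochner_Integration.integrable_bound[OF B(2)])
      \<comment> \<open>For the difference \<open>g (Suc n) x - g n x\<close> weak measurability is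
        enough, and it follows termwise from inner products with fixed vectors.\<close>
      have [measurable]: "(\<lambda>x. inner (g n x) (g (Suc n) x - g n x)) \<in> borel_measurable M"
        by (rule borel_measurable_inner_countable_closure[OF D gM g(2)])
          (unfold inner_diff_right, intro borel_measurable_diff ing)
      show "L n \<in> borel_measurable M"
        unfolding L_def by measurable
      show "AE x in M. norm (L n x) \<le> norm (4 * B x)"
      proof (rule AE_I2)
        fix x
        have "norm (L n x) \<le> \<bar>2 * V n x / Y n x\<bar> * (norm (g n x) * norm (g (Suc n) x - g n x))"
          unfolding L_def real_norm_def abs_mult[of "2 * V n x / Y n x"]
          by (intro mult_left_mono Cauchy_Schwarz_ineq2) simp
        also have "\<dots> \<le> 4 * B x"
          using coeff[OF n] by (simp add: mult.assoc)
        finally show "norm (L n x) \<le> norm (4 * B x)" by simp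
      qed
    qed
    show "(\<integral>x. L n x \<partial>M) = 0"
      unfolding L_def
    proof (rule integral_inner_eq_0[OF D g(1) g(2) _ _ _ B(2)])
      show "(\<lambda>x. 2 * V n x / Y n x) \<in> borel_measurable (F n)"
        using V(1)[of n] YF[of n] by measurable
      show "integrable M (\<lambda>x. inner z (g (Suc n) x - g n x))" for z
        by (simp add: inner_diff_right g(3))
      show "(\<integral>x\<in>A. inner z (g (Suc n) x - g n x) \<partial>M) = 0" if A: "A \<in> sets (F n)" for z A
      proof -
        have "A \<in> sets M"
          using A sub by (auto simp: subalgebra_def)
        then have "set_integrable M A (\<lambda>x. inner z (g m x))" for m
          unfolding set_integrable_def by (intro integrable_mult_indicator g(3))
        then show ?thesis
          by (simp add: inner_diff_right set_integral_diff g(4)[OF A])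
      qed
    qed (use coeff[OF n] in auto)
  qed
  \<comment> \<open>The induction compares the partial sums with \<open>R n\<close> itself:
    nonnegativity of \<open>R 0\<close> starts it, and \<open>L_zero\<close> removes the inner
    product term at each step.\<close>
  have "(\<Sum>k=1..n. (\<integral>x. T k x \<partial>M)) \<le> (\<integral>x. R n x \<partial>M)" if "n \<le> N" for n
    using that
  proof (induction n)
    case 0
    show ?case
      using R_bound(1)[of 0] by (simp add: integral_nonneg_AE)
  next
    case (Suc n)
    have n: "n \<le> N" "Suc n \<le> N" using Suc.prems by auto
    have "(\<integral>x. R n x \<partial>M) + (\<integral>x. T (Suc n) x \<partial>M) = (\<integral>x. R n x + L n x + T (Suc n) x \<partial>M)"
      using R_int[OF n(1)] L_int[OF n(2)] T_int[OF n(2)] L_zero[OF n(2)] by simp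
    also have "\<dots> \<le> (\<integral>x. R (Suc n) x \<partial>M)"
    proof (rule integral_mono)
      show "R n x + L n x + T (Suc n) x \<le> R (Suc n) x" for x
        using davis_step[OF gY[of n x] V(2)[of n x] incseqD[OF V(3), of n "Suc n" x], of "g (Suc n) x"]
        by (simp add: R_def L_def T_def Y_def)
    qed (use R_int n L_int T_int in auto)
    finally show ?case
      using Suc.IH n by simp
  qed
  from this[of N] have "(\<Sum>n=1..N. (\<integral>x. T n x \<partial>M)) \<le> (\<integral>x. R N x \<partial>M)" by simp
  also have "\<dots> \<le> (\<integral>x. 4 * B x \<partial>M)"
    using R_bound(2)[of N] R_int[of N] B(2) by (intro integral_mono) auto
  finally show "(\<Sum>n=1..N. (\<integral>x. T n x \<partial>M)) \<le> 4 * (\<integral>x. V N x * Y N x \<partial>M)"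
    by (simp add: B_def)
qed

section \<open>Reduction to a separably valued version of the martingale\<close>

text \<open>The inner product with a fixed \<open>z\<close> commutes with the strong integral. The
  vector identity defining the conditional expectation thus becomes a family of real ones, the form
  in which the martingale property is used.\<close>

lemma is_cond_exp_inner_set_integral:
  fixes f g :: "'a \<Rightarrow> 'b::{real_inner, banach}"
  assumes "is_cond_exp M G f g" "subalgebra M G" "A \<in> sets G"
  shows "(\<integral>x\<in>A. inner z (f x) \<partial>M) = (\<integral>x\<in>A. inner z (g x) \<partial>M)"
proof -
  have A: "A \<in> sets M"
    using assms by (auto simp: subalgebra_def)
  have *: "(\<integral>x\<in>A. inner z (h x) \<partial>M) = inner z (strong_integral M (\<lambda>x. indicator A x *\<^sub>R h x))"
    if "strongly_integrable M h" for h :: "'a \<Rightarrow> 'b"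
    using has_bochner_integral_inner_strong[OF strongly_integrable_indicator[OF that A], of z]
    by (simp add: set_lebesgue_integral_def has_bochner_integral_integral_eq)
  show ?thesis
    using assms by (simp add: is_cond_exp_def *)
qed

text \<open>Replacing each \<open>f n\<close> by \<open>0\<close> off the closed set that carries it almost surely makes
  everything separably valued while keeping adaptedness, although the filtration need not be complete.\<close>

lemma martingale_countable_closure_version:
  fixes f :: "nat \<Rightarrow> 'a \<Rightarrow> 'b::{real_inner, banach}"
  assumes mart: "martingale M F f" and sub: "\<And>n. subalgebra M (F n)"
  obtains D and g :: "nat \<Rightarrow> 'a \<Rightarrow> 'b" where "countable D" "0 \<in> D"
    "\<And>n. g n \<in> borel_measurable (F n)" "\<And>n x. g n x \<in> closure D"
    "\<And>n z. integrable M (\<lambda>x. inner z (g n x))"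
    "\<And>n z A. A \<in> sets (F n) \<Longrightarrow>
      (\<integral>x\<in>A. inner z (g (Suc n) x) \<partial>M) = (\<integral>x\<in>A. inner z (g n x) \<partial>M)"
    "AE x in M. \<forall>n. g n x = f n x"
proof -
  have f: "f n \<in> borel_measurable (F n)" "strongly_integrable M (f n)"
    "is_cond_exp M (F n) (f (Suc n)) (f n)" for n
    using mart by (auto simp: martingale_def)
  have "\<exists>D. countable D \<and> 0 \<in> D \<and> (AE x in M. f n x \<in> closure D)" for n
    by (rule AE_in_closure_countable_strong[OF f(2)]) blast
  then obtain E where E: "\<And>n. countable (E n)" "\<And>n. 0 \<in> E n" "\<And>n. AE x in M. f n x \<in> closure (E n)"
    by metis
  \<comment> \<open>A countable union of countable sets serves all times at once.\<close>
  define D where "D = (\<Union>n. E n)"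
  have D: "countable D" "0 \<in> D"
    using E(1,2) by (auto simp: D_def)
  define g where "g n x = (if f n x \<in> closure D then f n x else 0)" for n x
  have gF: "g n \<in> borel_measurable (F n)" for n
  proof -
    have "f n -` closure D \<inter> space (F n) \<in> sets (F n)"
      by (rule measurable_sets[OF f(1)]) simp
    then show ?thesis
      unfolding g_def
      by (intro measurable_If f(1)) (auto simp: vimage_def Int_def conj_commute)
  qed
  have gM: "g n \<in> borel_measurable M" and fM: "f n \<in> borel_measurable M" for n
    by (rule measurable_from_subalg[OF sub gF], rule measurable_from_subalg[OF sub f(1)])
  have ing [measurable]: "(\<lambda>x. inner z (g n x)) \<in> borel_measurable M"
    "(\<lambda>x. inner z (f n x)) \<in> borel_measurable M" for n z
    by (rule borel_measurable_continuous_on[OF _ gM] borel_measurable_continuous_on[OF _ fM],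
        intro continuous_intros)+
  have ae: "AE x in M. g n x = f n x" for n
    using E(3)[of n]
  proof eventually_elim
    case (elim x)
    then have "f n x \<in> closure D"
      using closure_mono[of "E n" D] by (auto simp: D_def)
    then show ?case by (simp add: g_def)
  qed
  have set_eq: "(\<integral>x\<in>A. inner z (g n x) \<partial>M) = (\<integral>x\<in>A. inner z (f n x) \<partial>M)"
    if [measurable]: "A \<in> sets M" for A z n
    unfolding set_lebesgue_integral_def
  proof (rule integral_cong_AE)
    show "AE x in M. indicator A x *\<^sub>R inner z (g n x) = indicator A x *\<^sub>R inner z (f n x)"
      using ae[of n] by eventually_elim simp
  qed measurable
  show ?thesis
  proof
    show "countable D" "0 \<in> D" by (rule D)+
    show "g n \<in> borel_measurable (F n)" for n by (rule gF)
    show "g n x \<in> closure D" for n x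
      using closure_subset[of D] D(2) by (auto simp: g_def)
    show "integrable M (\<lambda>x. inner z (g n x))" for n z
    proof (rule integrable_cong_AE_imp)
      show "integrable M (\<lambda>x. inner z (f n x))"
        using has_bochner_integral_inner_strong[OF f(2)] by (rule integrable.intros)
      show "AE x in M. inner z (f n x) = inner z (g n x)"
        using ae[of n] by eventually_elim simp
    qed measurable
    show "(\<integral>x\<in>A. inner z (g (Suc n) x) \<partial>M) = (\<integral>x\<in>A. inner z (g n x) \<partial>M)"
      if A: "A \<in> sets (F n)" for n z A
    proof -
      have "A \<in> sets M"
        using A sub by (auto simp: subalgebra_def)
      then show ?thesis
        by (simp add: set_eq is_cond_exp_inner_set_integral[OF f(3) sub A])
    qed
    show "AE x in M. \<forall>n. g n x = f n x"
      unfolding AE_all_countable using ae by simp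
  qed
qed

subsection \<open>The weighted square function\<close>

text \<open>If the characteristic were 0, the conditional expectation of \<open>w\<close> given
  \<open>F 0\<close> would vanish, hence also the integral of \<open>w\<close>, against
  \<open>0 < w x\<close>. Positivity allows division by its square root in the final
  splitting.\<close>

lemma A1_char_pos:
  assumes "prob_space M" "\<And>n. subalgebra M (F n)" "A1_weight M F w"
  shows "0 < A1_char M F w"
proof -
  interpret prob_space M by fact
  interpret finite_measure_subalgebra M "F 0"
    by unfold_locales (rule assms)
  have w: "weight M w" and [measurable]: "w \<in> borel_measurable M" and pos: "AE x in M. 0 < w x"
    using assms(3) by (auto simp: A1_weight_def weight_def)
  have C: "A1_char M F w \<in> A1_bounds M F w"
    by (rule A1_char_in_A1_bounds[OF assms])
  have "A1_char M F w \<noteq> 0"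
  proof
    assume "A1_char M F w = 0"
    with C have "AE x in M. weight_max M F w x \<le> 0"
      by (simp add: A1_bounds_def)
    then have "AE x in M. nn_cond_exp M (F 0) (\<lambda>y. ennreal (w y)) x = 0"
    proof eventually_elim
      case (elim x)
      have "nn_cond_exp M (F 0) (\<lambda>y. ennreal (w y)) x \<le> weight_max M F w x"
        unfolding weight_max_def by (rule SUP_upper) simp
      with elim show ?case by simp
    qed
    then have "(\<integral>\<^sup>+x. nn_cond_exp M (F 0) (\<lambda>y. ennreal (w y)) x \<partial>M) = (\<integral>\<^sup>+x. 0 \<partial>M)"
      by (rule nn_integral_cong_AE)
    then have "(\<integral>\<^sup>+x. ennreal (w x) \<partial>M) = 0"
      using nn_cond_exp_intg[of "\<lambda>_. 1" "\<lambda>y. ennreal (w y)"] by simp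
    then have "AE x in M. ennreal (w x) = 0"
      by (simp add: nn_integral_0_iff_AE)
    with pos have "AE x in M. False"
      by eventually_elim (simp add: ennreal_eq_0_iff)
    then show False by simp
  qed
  with A1_bounds_nonneg[OF assms(1,2) w C] show ?thesis by simp
qed

text \<open>Each quotient is multiplied back by \<open>y n\<close>, which is at most
  \<open>y N\<close>; this bounds the sum of squares by a product. The arithmetic-geometric mean
  inequality with free parameter \<open>r\<close> then makes the bound linear in both
  factors.\<close>

lemma square_fun_le:
  fixes g :: "nat \<Rightarrow> 'a \<Rightarrow> 'b::real_normed_vector" and y :: "nat \<Rightarrow> real"
  assumes r: "0 < r"
    and y: "\<And>n. norm (g n x) \<le> y n" "incseq y"
  shows "square_fun N g x
    \<le> (\<Sum>n=1..N. (norm (g n x - g (n - 1) x))\<^sup>2 / y n) / (4 * r) + r * y N"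
proof -
  define S where "S = (\<Sum>n=1..N. (norm (g n x - g (n - 1) x))\<^sup>2 / y n)"
  have y0: "0 \<le> y n" for n
    by (rule order_trans[OF norm_ge_zero y(1)])
  have S0: "0 \<le> S"
    unfolding S_def by (intro sum_nonneg divide_nonneg_nonneg y0) simp
  have "(\<Sum>n=1..N. (norm (g n x - g (n - 1) x))\<^sup>2) \<le> S * y N"
    unfolding S_def sum_distrib_right
  proof (rule sum_mono)
    fix n assume n: "n \<in> {1..N}"
    define q where "q = (norm (g n x - g (n - 1) x))\<^sup>2"
    \<comment> \<open>If \<open>y n = 0\<close>, the quotient is 0 by convention, but monotonicity
      of \<open>y\<close> makes both \<open>g n x\<close> and \<open>g (n - 1) x\<close> vanish, so
      \<open>q = 0\<close> as well.\<close>
    have "q = q / y n * y n"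
    proof (cases "y n = 0")
      case True
      have "y (n - 1) \<le> y n"
        using y(2) by (auto intro: incseqD)
      with True y(1)[of n] y(1)[of "n - 1"] have "norm (g n x) \<le> 0" "norm (g (n - 1) x) \<le> 0"
        by linarith+
      then show ?thesis by (simp add: q_def)
    qed simp
    also have "\<dots> \<le> q / y n * y N"
      using n incseqD[OF y(2), of n N] y0 by (intro mult_left_mono) (auto simp: q_def)
    finally show "(norm (g n x - g (n - 1) x))\<^sup>2
        \<le> (norm (g n x - g (n - 1) x))\<^sup>2 / y n * y N"
      unfolding q_def .
  qed
  then have "square_fun N g x \<le> sqrt (S * y N)"
    unfolding square_fun_def by (rule real_sqrt_le_mono)
  \<comment> \<open>The factor \<open>2 * r\<close> is chosen so that the mean has the coefficients
    \<open>1 / (4 * r)\<close> and \<open>r\<close>.\<close>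
  also have "\<dots> = sqrt (S / (2 * r) * (2 * r * y N))"
    using r by simp
  also have "\<dots> \<le> (S / (2 * r) + 2 * r * y N) / 2"
    using r S0 y0 by (intro arith_geo_mean_sqrt) auto
  also have "\<dots> = S / (4 * r) + r * y N"
    using r by (simp add: field_simps)
  finally show ?thesis
    unfolding S_def .
qed

theorem mainTheorem5:
  fixes M :: "'a measure"
    and F :: "nat \<Rightarrow> 'a measure"
    and f :: "nat \<Rightarrow> 'a \<Rightarrow> 'b::{real_inner, banach}"
    and w :: "'a \<Rightarrow> real"
    and N :: nat
  assumes "prob_space M"
    and "filtration (space M) F"
    and "\<And>n. subalgebra M (F n)"
    and "martingale M F f"
    and "AE x in M. f 0 x = 0"
    and "integrable M w"
    and "A1_weight M F w"
  shows "(\<integral>\<^sup>+ x. ennreal (square_fun N f x * w x) \<partial>M)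
    \<le> ennreal (2 * sqrt (A1_char M F w)) * (\<integral>\<^sup>+ x. martingale_max f x * ennreal (w x) \<partial>M)"
proof -
  interpret prob_space M by fact
  interpret finite_measure_subalgebra M "F n" for n
    by unfold_locales (rule assms)
  note filt = assms(2) and sub = assms(3)
  define C where "C = A1_char M F w"
  have C: "0 < C"
    unfolding C_def using assms(1,3,7) by (rule A1_char_pos)
  \<comment> \<open>This value balances the two final terms: the sum contributes
    \<open>4 * C / (4 * r)\<close> and the maximal function contributes \<open>r\<close>, which are
    equal when \<open>r * r = C\<close> and add up to \<open>2 * r\<close>.\<close>
  define r where "r = sqrt C"
  have r: "0 < r" "r * r = C"
    using C by (simp_all add: r_def)
  have wM [measurable]: "w \<in> borel_measurable M" and wpos: "AE x in M. 0 < w x"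
    using assms(7) by (auto simp: A1_weight_def weight_def)
  obtain D and g :: "nat \<Rightarrow> 'a \<Rightarrow> 'b" where D: "countable D" "0 \<in> D"
    and g: "\<And>n. g n \<in> borel_measurable (F n)" "\<And>n x. g n x \<in> closure D"
      "\<And>n z. integrable M (\<lambda>x. inner z (g n x))"
      "\<And>n z A. A \<in> sets (F n) \<Longrightarrow>
        (\<integral>x\<in>A. inner z (g (Suc n) x) \<partial>M) = (\<integral>x\<in>A. inner z (g n x) \<partial>M)"
    and gf: "AE x in M. \<forall>n. g n x = f n x"
    using martingale_countable_closure_version[OF assms(4) sub] by blast

  \<comment> \<open>Adapted maximal processes of the martingale and of the weight\<close>
  define Y where "Y = running_max (\<lambda>n x. norm (g n x))"
  define W where "W n x = enn2real (nn_cond_exp M (F n) (\<lambda>y. ennreal (w y)) x)" for n x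
  \<comment> \<open>The running maximum is adapted, real valued and nondecreasing in time, as the
    summation estimate requires, whereas \<open>weight_max\<close> looks at all times.\<close>
  define V where "V = running_max W"
  define Q where "Q n x = (norm (g n x - g (n - 1) x))\<^sup>2 / Y n x" for n x
  have gY: "norm (g n x) \<le> Y n x" for n x
    unfolding Y_def by (rule le_running_max)
  have Y0: "0 \<le> Y n x" for n x
    by (rule order_trans[OF norm_ge_zero gY])
  have Q0: "0 \<le> Q n x" for n x
    unfolding Q_def using Y0 by simp
  have WF: "W n \<in> borel_measurable (F n)" for n
    unfolding W_def by measurable
  have VF: "V n \<in> borel_measurable (F n)" for n
    unfolding V_def by (rule borel_measurable_running_max[OF filt WF])
  have YF: "Y n \<in> borel_measurable (F n)" for n
    unfolding Y_def
    by (intro borel_measurable_running_max[OF filt] measurable_compose[OF g(1) borel_measurable_norm])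
  have QF: "Q n \<in> borel_measurable (F n)" for n
  proof -
    have "(\<lambda>x. norm (g n x - g (n - 1) x)) \<in> borel_measurable (F n)"
      by (rule borel_measurable_norm_diff_countable_closure[OF D
            borel_measurable_filtration_mono[OF filt _ g(1)] g(2) g(1)]) simp
    with YF[of n] show ?thesis
      unfolding Q_def by measurable
  qed
  have [measurable]: "V n \<in> borel_measurable M" "Y n \<in> borel_measurable M" "Q n \<in> borel_measurable M" for n
    using VF YF QF by (auto intro: measurable_from_subalg[OF sub])
  have WV: "W n x \<le> V n x" for n x
    unfolding V_def by (rule le_running_max)
  have V0: "0 \<le> V n x" for n x
    by (rule order_trans[OF _ WV]) (simp add: W_def)
  have "C \<in> A1_bounds M F w"
    unfolding C_def using assms(1,3,7) by (rule A1_char_in_A1_bounds)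
  then have "AE x in M. weight_max M F w x \<le> ennreal (C * w x)"
    by (simp add: A1_bounds_def)
  \<comment> \<open>The \<open>A1\<close> bound makes the conditional expectations finite almost
    everywhere. There \<open>W n x\<close> is the true value and not the 0 that
    \<open>enn2real\<close> returns at infinity.\<close>
  then have Vw: "AE x in M. \<forall>n. V n x \<le> C * w x \<and> nn_cond_exp M (F n) (\<lambda>y. ennreal (w y)) x \<le> ennreal (V n x)"
    using wpos
  proof eventually_elim
    case (elim x)
    have E: "nn_cond_exp M (F n) (\<lambda>y. ennreal (w y)) x \<le> ennreal (C * w x)" for n
      by (rule order_trans[OF _ elim(1)]) (auto simp: weight_max_def intro: SUP_upper)
    have "W n x \<le> C * w x" for n
      using enn2real_mono[OF E[of n]] C elim(2) by (simp add: W_def)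
    then have "V n x \<le> C * w x" for n
      unfolding V_def by (rule running_max_le)
    moreover have "nn_cond_exp M (F n) (\<lambda>y. ennreal (w y)) x \<le> ennreal (V n x)" for n
    proof -
      have "nn_cond_exp M (F n) (\<lambda>y. ennreal (w y)) x = ennreal (W n x)"
        using le_less_trans[OF E[of n] ennreal_less_top] by (simp add: W_def)
      then show ?thesis using WV by (simp add: ennreal_leI)
    qed
    ultimately show ?case by blast
  qed
  define J where "J = (\<integral>\<^sup>+x. ennreal (Y N x) * ennreal (w x) \<partial>M)"
  have J: "J \<le> (\<integral>\<^sup>+x. martingale_max f x * ennreal (w x) \<partial>M)"
    unfolding J_def
  proof (rule nn_integral_mono_AE)
    show "AE x in M. ennreal (Y N x) * ennreal (w x) \<le> martingale_max f x * ennreal (w x)"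
      using gf
    proof eventually_elim
      case (elim x)
      have "ennreal (Y n x) \<le> martingale_max f x" for n
      proof (induction n)
        case 0
        then show ?case
          unfolding Y_def martingale_max_def by (auto simp: elim intro: SUP_upper)
      next
        case (Suc n)
        have "ennreal (norm (g (Suc n) x)) \<le> martingale_max f x"
          unfolding martingale_max_def by (auto simp: elim intro: SUP_upper)
        with Suc show ?case
          by (simp add: Y_def max_def)
      qed
      then show ?case by (intro mult_right_mono) auto
    qed
  qed
  have "(\<integral>\<^sup>+x. ennreal (square_fun N f x * w x) \<partial>M) \<le> ennreal (2 * r) * J"
  \<comment> \<open>An infinite \<open>J\<close> makes the right side infinite because
    \<open>r\<close> is positive. Otherwise \<open>Y N x * w x\<close> is integrable and real
    integrals can be used.\<close>
  proof (cases "J = \<infinity>")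
    case True
    then show ?thesis
      using r by (simp add: ennreal_mult_top)
  next
    case False
    have Yw: "integrable M (\<lambda>x. Y N x * w x)"
    proof (rule integrableI_bounded)
      have "(\<integral>\<^sup>+x. ennreal (norm (Y N x * w x)) \<partial>M) = J"
        unfolding J_def using wpos Y0
        by (intro nn_integral_cong_AE) (auto simp: abs_mult ennreal_mult)
      then show "(\<integral>\<^sup>+x. ennreal (norm (Y N x * w x)) \<partial>M) < \<infinity>"
        using False by (simp add: top.not_eq_extremum)
    qed measurable
    have J_eq: "J = ennreal (\<integral>x. Y N x * w x \<partial>M)"
    proof -
      have "J = (\<integral>\<^sup>+x. ennreal (Y N x * w x) \<partial>M)"
        unfolding J_def using wpos Y0
        by (intro nn_integral_cong_AE) (auto simp: ennreal_mult)
      also have "\<dots> = ennreal (\<integral>x. Y N x * w x \<partial>M)"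
        using wpos Y0 by (intro nn_integral_eq_integral Yw) auto
      finally show ?thesis .
    qed
    \<comment> \<open>This turns the maximal weight at time \<open>N\<close> back into
      \<open>w\<close>, at the price of one factor \<open>C\<close>.\<close>
    have VY_le: "AE x in M. V N x * Y N x \<le> C * (Y N x * w x)"
      using Vw
    proof eventually_elim
      case (elim x)
      then have "V N x * Y N x \<le> C * w x * Y N x"
        using Y0 by (intro mult_right_mono) auto
      then show ?case by (simp add: algebra_simps)
    qed
    have VY: "integrable M (\<lambda>x. V N x * Y N x)"
    proof (rule Bochner_Integration.integrable_bound)
      show "integrable M (\<lambda>x. C * (Y N x * w x))" using Yw by simp
      show "AE x in M. norm (V N x * Y N x) \<le> norm (C * (Y N x * w x))"
        using VY_le
      proof eventually_elim
        case (elim x)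
        then show ?case
          using V0[of N x] Y0[of N x] mult_nonneg_nonneg[OF V0[of N x] Y0[of N x]] by simp
      qed
    qed measurable

    \<comment> \<open>The weighted sum of the quotients \<open>Q n\<close>\<close>
    have incV: "incseq (\<lambda>n. V n x)" and incY: "incseq (\<lambda>n. Y n x)" for x
      unfolding V_def Y_def by (auto intro!: monoI running_max_mono)
    note T = sum_weighted_differences_le[OF finite_measure_axioms filt sub D g VF V0 incV
        VY[unfolded Y_def], folded Y_def, folded Q_def]
    have T_int: "integrable M (\<lambda>x. V n x * Q n x)" if "n \<in> {1..N}" for n
      by (rule T(1)[OF _ that])
    have T_sum: "(\<Sum>n=1..N. (\<integral>x. V n x * Q n x \<partial>M)) \<le> 4 * (\<integral>x. V N x * Y N x \<partial>M)"
      by (rule T(2))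
    have "(\<integral>\<^sup>+x. ennreal (\<Sum>n=1..N. Q n x) * ennreal (w x) \<partial>M)
        = (\<integral>\<^sup>+x. (\<Sum>n=1..N. ennreal (Q n x) * ennreal (w x)) \<partial>M)"
      using Q0 by (simp add: sum_distrib_right[symmetric])
    also have "\<dots> = (\<Sum>n=1..N. (\<integral>\<^sup>+x. ennreal (Q n x) * ennreal (w x) \<partial>M))"
      by (rule nn_integral_sum) measurable
    also have "\<dots> \<le> (\<Sum>n=1..N. ennreal (\<integral>x. V n x * Q n x \<partial>M))"
    proof (rule sum_mono)
      \<comment> \<open>Since \<open>Q n\<close> is \<open>F n\<close>-measurable, \<open>w\<close>
        may be replaced under the integral by its conditional expectation, which \<open>V n\<close>
        dominates.\<close>
      fix n assume n: "n \<in> {1..N}"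
      have "(\<integral>\<^sup>+x. ennreal (Q n x) * ennreal (w x) \<partial>M)
          = (\<integral>\<^sup>+x. ennreal (Q n x) * nn_cond_exp M (F n) (\<lambda>y. ennreal (w y)) x \<partial>M)"
        by (rule nn_cond_exp_intg[symmetric, OF measurable_compose[OF QF measurable_ennreal]])
          measurable
      also have "\<dots> \<le> (\<integral>\<^sup>+x. ennreal (V n x * Q n x) \<partial>M)"
      proof (rule nn_integral_mono_AE)
        show "AE x in M. ennreal (Q n x) * nn_cond_exp M (F n) (\<lambda>y. ennreal (w y)) x
            \<le> ennreal (V n x * Q n x)"
          using Vw
        proof eventually_elim
          case (elim x)
          then have "ennreal (Q n x) * nn_cond_exp M (F n) (\<lambda>y. ennreal (w y)) x
              \<le> ennreal (Q n x) * ennreal (V n x)"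
            by (intro mult_left_mono) auto
          then show ?case
            using Q0 V0 by (simp add: ennreal_mult mult.commute)
        qed
      qed
      also have "\<dots> = ennreal (\<integral>x. V n x * Q n x \<partial>M)"
        using T_int[OF n] Q0 V0 by (intro nn_integral_eq_integral) auto
      finally show "(\<integral>\<^sup>+x. ennreal (Q n x) * ennreal (w x) \<partial>M)
          \<le> ennreal (\<integral>x. V n x * Q n x \<partial>M)" .
    qed
    also have "\<dots> = ennreal (\<Sum>n=1..N. (\<integral>x. V n x * Q n x \<partial>M))"
      using Q0 V0 by (intro sum_ennreal integral_nonneg_AE) auto
    also have "\<dots> \<le> ennreal (4 * (\<integral>x. C * (Y N x * w x) \<partial>M))"
    proof (rule ennreal_leI)
      have "(\<integral>x. V N x * Y N x \<partial>M) \<le> (\<integral>x. C * (Y N x * w x) \<partial>M)"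
        using VY_le VY Yw by (intro integral_mono_AE) auto
      with T_sum show "(\<Sum>n=1..N. (\<integral>x. V n x * Q n x \<partial>M)) \<le> 4 * (\<integral>x. C * (Y N x * w x) \<partial>M)"
        by simp
    qed
    also have "\<dots> = ennreal (4 * C) * J"
      using C by (simp add: J_eq ennreal_mult'[symmetric] mult.assoc)
    finally have sumQ: "(\<integral>\<^sup>+x. ennreal (\<Sum>n=1..N. Q n x) * ennreal (w x) \<partial>M) \<le> ennreal (4 * C) * J" .

    \<comment> \<open>From the weighted sum to the square function\<close>
    have "(\<integral>\<^sup>+x. ennreal (square_fun N f x * w x) \<partial>M)
        \<le> (\<integral>\<^sup>+x. ennreal (1 / (4 * r)) * (ennreal (\<Sum>n=1..N. Q n x) * ennreal (w x))
            + ennreal r * (ennreal (Y N x) * ennreal (w x)) \<partial>M)"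
    proof (rule nn_integral_mono_AE)
      show "AE x in M. ennreal (square_fun N f x * w x)
        \<le> ennreal (1 / (4 * r)) * (ennreal (\<Sum>n=1..N. Q n x) * ennreal (w x))
            + ennreal r * (ennreal (Y N x) * ennreal (w x))"
        using gf wpos
      proof eventually_elim
        case (elim x)
        have S0: "0 \<le> (\<Sum>n=1..N. Q n x)"
          by (intro sum_nonneg Q0)
        have "square_fun N f x = square_fun N g x"
          using elim(1) by (simp add: square_fun_def)
        also have "\<dots> \<le> (\<Sum>n=1..N. Q n x) / (4 * r) + r * Y N x"
          unfolding Q_def by (rule square_fun_le[OF r(1) gY incY])
        finally have "square_fun N f x * w x \<le> ((\<Sum>n=1..N. Q n x) / (4 * r) + r * Y N x) * w x"
          using elim(2) by (intro mult_right_mono) auto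
        also have "\<dots> = 1 / (4 * r) * ((\<Sum>n=1..N. Q n x) * w x) + r * (Y N x * w x)"
          by (simp add: algebra_simps)
        finally have "ennreal (square_fun N f x * w x)
            \<le> ennreal (1 / (4 * r) * ((\<Sum>n=1..N. Q n x) * w x) + r * (Y N x * w x))"
          by (rule ennreal_leI)
        also have "\<dots> = ennreal (1 / (4 * r)) * (ennreal (\<Sum>n=1..N. Q n x) * ennreal (w x))
            + ennreal r * (ennreal (Y N x) * ennreal (w x))"
          using r(1) S0 Y0[of N x] elim(2) by (simp flip: ennreal_mult ennreal_plus)
        finally show ?case .
      qed
    qed
    also have "\<dots> = ennreal (1 / (4 * r)) * (\<integral>\<^sup>+x. ennreal (\<Sum>n=1..N. Q n x) * ennreal (w x) \<partial>M) + ennreal r * J"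
      unfolding J_def by (simp add: nn_integral_add nn_integral_cmult)
    also have "\<dots> \<le> ennreal (1 / (4 * r)) * (ennreal (4 * C) * J) + ennreal r * J"
      by (intro add_right_mono mult_left_mono sumQ) simp
    also have "\<dots> = ennreal (1 / (4 * r) * (4 * C) + r) * J"
      using r C by (simp add: ennreal_plus ennreal_mult'[symmetric] distrib_right mult.assoc[symmetric])
    also have "1 / (4 * r) * (4 * C) + r = 2 * r"
      using r by (simp add: field_simps)
    finally show ?thesis .
  qed
  also have "\<dots> \<le> ennreal (2 * r) * (\<integral>\<^sup>+x. martingale_max f x * ennreal (w x) \<partial>M)"
    by (intro mult_left_mono J) simp
  finally show ?thesis
    by (simp add: r_def C_def)
qed

end
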